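(* For every integer $n\geq 5$ with $n\equiv 1$ or $5\pmod 6$, there exists a regular SAMS$(n,2)$.
   Context: For positive integers $n,d$ with $d<n$, an $n\times n$ array $A$ with entries in $\{0,1,\dots,nd\}$ is a sparse anti-magic square of order $n$ with density $d$, denoted SAMS$(n,d)$, if each element of $\{1,2,\dots,nd\}$ occurs in exactly one entry of $A$ (all other entries being $0$), and the $n$ row-sums, $n$ column-sums and the two main diagonal sums (left diagonal: entries $(i,i)$; right diagonal: entries $(i,n+1-i)$) together form a set of $2n+2$ consecutive integers. An SAMS$(n,d)$ is regular if each row, each column and each of the two main diagonals contains exactly $d$ positive entries. *)

theory Defs
  imports Main
begin

text \<open>
  An array of order \<open>n\<close> is a function \<open>nat \<Rightarrow> nat \<Rightarrow> nat\<close> with row and column indices in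
  \<open>{1..n}\<close>; its values at other indices are irrelevant.
\<close>

definition row_sum :: "nat \<Rightarrow> (nat \<Rightarrow> nat \<Rightarrow> nat) \<Rightarrow> nat \<Rightarrow> nat" where
  "row_sum n A i = (\<Sum>j = 1..n. A i j)"

definition col_sum :: "nat \<Rightarrow> (nat \<Rightarrow> nat \<Rightarrow> nat) \<Rightarrow> nat \<Rightarrow> nat" where
  "col_sum n A j = (\<Sum>i = 1..n. A i j)"

definition left_diag_sum :: "nat \<Rightarrow> (nat \<Rightarrow> nat \<Rightarrow> nat) \<Rightarrow> nat" where
  "left_diag_sum n A = (\<Sum>i = 1..n. A i i)"

definition right_diag_sum :: "nat \<Rightarrow> (nat \<Rightarrow> nat \<Rightarrow> nat) \<Rightarrow> nat" where
  "right_diag_sum n A = (\<Sum>i = 1..n. A i (n + 1 - i))"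

definition line_sums :: "nat \<Rightarrow> (nat \<Rightarrow> nat \<Rightarrow> nat) \<Rightarrow> nat set" where
  "line_sums n A =
     row_sum n A ` {1..n} \<union> col_sum n A ` {1..n} \<union> {left_diag_sum n A, right_diag_sum n A}"

text \<open>
  In the last conjunct the interval has \<open>2 * n + 2\<close> elements, so the equation also forces the
  \<open>2 * n + 2\<close> line sums to be pairwise distinct. As all sums are nonnegative, it loses no generality
  to let the consecutive integers be natural numbers.
\<close>

definition is_SAMS :: "nat \<Rightarrow> nat \<Rightarrow> (nat \<Rightarrow> nat \<Rightarrow> nat) \<Rightarrow> bool" where
  "is_SAMS n d A \<longleftrightarrow>
     0 < d \<and> d < n \<and>
     (\<forall>i\<in>{1..n}. \<forall>j\<in>{1..n}. A i j \<in> {0..n * d}) \<and>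
     (\<forall>k\<in>{1..n * d}. \<exists>!p. p \<in> {1..n} \<times> {1..n} \<and> A (fst p) (snd p) = k) \<and>
     (\<exists>a. line_sums n A = {a..<a + (2 * n + 2)})"

definition is_regular_SAMS :: "nat \<Rightarrow> nat \<Rightarrow> (nat \<Rightarrow> nat \<Rightarrow> nat) \<Rightarrow> bool" where
  "is_regular_SAMS n d A \<longleftrightarrow>
     is_SAMS n d A \<and>
     (\<forall>i\<in>{1..n}. card {j\<in>{1..n}. A i j > 0} = d) \<and>
     (\<forall>j\<in>{1..n}. card {i\<in>{1..n}. A i j > 0} = d) \<and>
     card {i\<in>{1..n}. A i i > 0} = d \<and>
     card {i\<in>{1..n}. A i (n + 1 - i) > 0} = d"

end

theory Submission
  imports Defs "HOL-Number_Theory.Cong"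
begin

text \<open>
  Number rows and columns modulo \<open>n\<close> and fill two parallel toroidal lines of slope \<open>1/2\<close>.
  As \<open>n\<close> is prime to 6, each such line meets every row, every column and both main diagonals once,
  so the array is regular. Being adjacent, the two lines form one cycle of length \<open>2 n\<close> in which
  consecutive cells alternately share a row and a column. The line sums thus become sums of
  neighbouring labels on this cycle. The zigzag labelling \<open>n + 1, 2, n + 2, 3, \<dots>\<close> makes them
  consecutive apart from one collision; exchanging the two labels in one middle row and in the last
  row moves the sums to \<open>{n..3 n + 1}\<close> without \<open>n + 2\<close> and \<open>2 n - 1\<close>, and a suitable position of
  the lines makes these the two diagonal sums. The orders 5 and 7 are too small for this and have
  labellings found by search.
\<close>

section \<open>From a labelled cycle to a regular square\<close>

lemma sum_two_points:
  fixes f g :: "'a \<Rightarrow> nat"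
  assumes "finite S" "a \<in> S" "b \<in> S" "a \<noteq> b"
  shows "(\<Sum>k\<in>S. if k = a then f k else if k = b then g k else 0) = f a + g b"
proof -
  have "(\<Sum>k\<in>S. if k = a then f k else if k = b then g k else 0) =
    (\<Sum>k\<in>S. (if k = a then f k else 0) + (if k = b then g k else 0))"
    using assms(4) by (intro sum.cong) auto
  also have "\<dots> = f a + g b"
    using assms by (simp add: sum.distrib)
  finally show ?thesis .
qed

lemma card_two_points:
  fixes f g :: "'a \<Rightarrow> nat"
  assumes "a \<in> S" "b \<in> S" "a \<noteq> b" "f a > 0" "g b > 0"
  shows "card {k\<in>S. (if k = a then f k else if k = b then g k else 0) > 0} = 2"
proof -
  have "{k\<in>S. (if k = a then f k else if k = b then g k else 0) > 0} = {a, b}"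
    using assms by (auto split: if_splits)
  then show ?thesis
    using assms(3) by simp
qed

lemma bij_betw_Suc_mod:
  assumes "n > 0"
  shows "bij_betw (\<lambda>k. Suc k mod n) {..<n} {..<n}"
proof -
  have "(\<lambda>k. Suc k mod n) ` {..<n} = {..<n}"
  proof (intro equalityI subsetI)
    fix k assume k: "k \<in> {..<n}"
    show "k \<in> (\<lambda>k. Suc k mod n) ` {..<n}"
    proof (cases k)
      case 0
      then show ?thesis using assms by (intro image_eqI[of _ _ "n - 1"]) auto
    next
      case (Suc m)
      then show ?thesis using k by (intro image_eqI[of _ _ m]) auto
    qed
  qed (use assms in auto)
  then show ?thesis
    by (simp add: bij_betw_def eq_card_imp_inj_on)
qed

text \<open>
  The cells \<open>(R k, C k)\<close> and \<open>(R k, C (k + 1))\<close>, with indices modulo \<open>n\<close>, are the edges of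
  a single cycle through all rows and columns, and \<open>u\<close>, \<open>v\<close> label these edges alternately.
  The left diagonal meets the cells of \<open>u a\<close> and \<open>v b\<close>, the right one those of \<open>u c\<close> and \<open>v d\<close>.
\<close>

lemma regular_SAMS_from_cycle:
  fixes R C u v :: "nat \<Rightarrow> nat"
  assumes n: "n > 2"
    and R: "bij_betw R {..<n} {1..n}" and C: "bij_betw C {..<n} {1..n}"
    and inj_u: "inj_on u {..<n}" and inj_v: "inj_on v {..<n}"
    and disj: "u ` {..<n} \<inter> v ` {..<n} = {}"
    and labels: "u ` {..<n} \<union> v ` {..<n} = {1..2 * n}"
    and left_u: "\<And>k. k < n \<Longrightarrow> R k = C k \<longleftrightarrow> k = a"
    and left_v: "\<And>k. k < n \<Longrightarrow> R k = C (Suc k mod n) \<longleftrightarrow> k = b"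
    and right_u: "\<And>k. k < n \<Longrightarrow> R k + C k = n + 1 \<longleftrightarrow> k = c"
    and right_v: "\<And>k. k < n \<Longrightarrow> R k + C (Suc k mod n) = n + 1 \<longleftrightarrow> k = d"
    and lt: "a < n" "b < n" "c < n" "d < n"
    and sums: "(\<lambda>k. u k + v k) ` {..<n} \<union> (\<lambda>k. v k + u (Suc k mod n)) ` {..<n} \<union>
      {u a + v b, u c + v d} = {s..<s + (2 * n + 2)}"
  shows "\<exists>A. is_regular_SAMS n 2 A"
proof -
  define \<sigma> where "\<sigma> = (\<lambda>k. Suc k mod n)"
  \<comment> \<open>Row \<open>R k\<close> holds only its two cycle cells, so the array is described
    row by row, with \<open>K\<close> recovering the cycle position of a row.\<close>
  define K where "K = the_inv_into {..<n} R"
  define A where "A = (\<lambda>i j. if j = C (K i) then u (K i)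
    else if j = C (\<sigma> (K i)) then v (K i) else 0)"
  have \<sigma>: "bij_betw \<sigma> {..<n} {..<n}"
    unfolding \<sigma>_def using n by (intro bij_betw_Suc_mod) simp
  have \<sigma>_lt: "\<sigma> k < n" for k using n by (simp add: \<sigma>_def)
  have \<sigma>_neq: "\<sigma> k \<noteq> k" if "k < n" for k
    using that n by (cases "Suc k = n") (auto simp: \<sigma>_def)
  have \<sigma>_eq: "\<sigma> k = \<sigma> l \<longleftrightarrow> k = l" if "k < n" "l < n" for k l
    using \<sigma> that by (auto simp: bij_betw_def inj_on_def)
  have KR: "K (R k) = k" if "k < n" for k
    using R that by (auto simp: K_def bij_betw_def the_inv_into_f_f)
  have C_eq: "C k = C l \<longleftrightarrow> k = l" if "k < n" "l < n" for k l
    using C that by (auto simp: bij_betw_def inj_on_def)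
  have R_in: "R k \<in> {1..n}" and C_in: "C k \<in> {1..n}" if "k < n" for k
    using R C that by (auto simp: bij_betw_def)
  have AR: "A (R k) j = (if j = C k then u k else if j = C (\<sigma> k) then v k else 0)"
    if "k < n" for k j
    using KR[OF that] by (simp add: A_def)
  have u_pos: "u k > 0" and v_pos: "v k > 0" and u_le: "u k \<le> 2 * n" and v_le: "v k \<le> 2 * n"
    if "k < n" for k
  proof -
    have "u k \<in> {1..2 * n}" "v k \<in> {1..2 * n}"
      using that unfolding labels[symmetric] by auto
    then show "u k > 0" "v k > 0" "u k \<le> 2 * n" "v k \<le> 2 * n" by auto
  qed
  have rowE: "\<exists>k<n. i = R k" if "i \<in> {1..n}" for i
    using R that by (auto simp: bij_betw_def)
  have colE: "\<exists>k<n. j = C (\<sigma> k)" if "j \<in> {1..n}" for j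
    using bij_betw_trans[OF \<sigma> C] that by (auto simp: bij_betw_def)
  have sum_R: "(\<Sum>i = 1..n. F i) = (\<Sum>k<n. F (R k))" for F :: "nat \<Rightarrow> nat"
    using sum.reindex_bij_betw[OF R, of F] by simp
  have card_R: "card {i\<in>{1..n}. F i > 0} = card {k\<in>{..<n}. F (R k) > 0}" for F :: "nat \<Rightarrow> nat"
  proof -
    have "{i\<in>{1..n}. F i > 0} = R ` {k\<in>{..<n}. F (R k) > 0}"
      using R by (auto simp: bij_betw_def)
    moreover have "inj_on R {k\<in>{..<n}. F (R k) > 0}"
      using R by (auto simp: bij_betw_def inj_on_def)
    ultimately show ?thesis by (simp add: card_image)
  qed

  have row: "row_sum n A (R k) = u k + v k" "card {j\<in>{1..n}. A (R k) j > 0} = 2"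
    if "k < n" for k
  proof -
    have neq: "C k \<noteq> C (\<sigma> k)"
      using that by (simp add: C_eq \<sigma>_lt \<sigma>_neq[symmetric])
    show "row_sum n A (R k) = u k + v k"
      unfolding row_sum_def AR[OF that]
      by (rule sum_two_points) (use neq C_in that \<sigma>_lt in auto)
    show "card {j\<in>{1..n}. A (R k) j > 0} = 2"
      unfolding AR[OF that]
      by (rule card_two_points) (use neq C_in that \<sigma>_lt u_pos v_pos in auto)
  qed
  \<comment> \<open>Column \<open>C (\<sigma> l)\<close> contains the \<open>v\<close>-cell of row
    \<open>R l\<close> and the \<open>u\<close>-cell of the next row \<open>R (\<sigma> l)\<close>.
    As \<open>\<sigma>\<close> permutes the positions, every column is listed once.\<close>
  have col: "col_sum n A (C (\<sigma> l)) = v l + u (\<sigma> l)" "card {i\<in>{1..n}. A i (C (\<sigma> l)) > 0} = 2"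
    if "l < n" for l
  proof -
    have *: "A (R k) (C (\<sigma> l)) = (if k = \<sigma> l then u k else if k = l then v k else 0)"
      if "k < n" for k
      using that \<open>l < n\<close> by (auto simp: AR C_eq \<sigma>_eq \<sigma>_lt)
    have "col_sum n A (C (\<sigma> l)) = (\<Sum>k<n. if k = \<sigma> l then u k else if k = l then v k else 0)"
      unfolding col_sum_def sum_R by (intro sum.cong) (auto simp: *)
    also have "\<dots> = u (\<sigma> l) + v l"
      using that \<sigma>_neq \<sigma>_lt by (intro sum_two_points) auto
    finally show "col_sum n A (C (\<sigma> l)) = v l + u (\<sigma> l)" by simp
    have "{k\<in>{..<n}. A (R k) (C (\<sigma> l)) > 0} =
      {k\<in>{..<n}. (if k = \<sigma> l then u k else if k = l then v k else 0) > 0}"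
      by (intro Collect_cong conj_cong refl) (simp only: lessThan_iff *)
    also have "card \<dots> = 2"
      using that \<sigma>_neq \<sigma>_lt u_pos v_pos by (intro card_two_points) auto
    finally show "card {i\<in>{1..n}. A i (C (\<sigma> l)) > 0} = 2"
      unfolding card_R .
  qed
  \<comment> \<open>One argument serves both diagonals: \<open>f\<close> is the identity for the
    left one and a reflection for the right one.\<close>
  have diag: "(\<Sum>i = 1..n. A i (f i)) = u x + v y" "card {i\<in>{1..n}. A i (f i) > 0} = 2"
    if "x < n" "y < n" and u: "\<And>k. k < n \<Longrightarrow> f (R k) = C k \<longleftrightarrow> k = x"
      and v: "\<And>k. k < n \<Longrightarrow> f (R k) = C (\<sigma> k) \<longleftrightarrow> k = y" for f x y
  proof -
    have "x \<noteq> y"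
      using u[of x] v[of x] that(1) C_eq[of x "\<sigma> x"] \<sigma>_neq[of x] \<sigma>_lt[of x] by auto
    have *: "A (R k) (f (R k)) = (if k = x then u k else if k = y then v k else 0)"
      if "k < n" for k
      using that by (simp add: AR u v)
    have "(\<Sum>i = 1..n. A i (f i)) = (\<Sum>k<n. if k = x then u k else if k = y then v k else 0)"
      unfolding sum_R by (intro sum.cong) (auto simp: *)
    also have "\<dots> = u x + v y"
      using that(1,2) \<open>x \<noteq> y\<close> by (intro sum_two_points) auto
    finally show "(\<Sum>i = 1..n. A i (f i)) = u x + v y" .
    have "{k\<in>{..<n}. A (R k) (f (R k)) > 0} =
      {k\<in>{..<n}. (if k = x then u k else if k = y then v k else 0) > 0}"
      by (intro Collect_cong conj_cong refl) (simp only: lessThan_iff *)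
    also have "card \<dots> = 2"
      using that(1,2) \<open>x \<noteq> y\<close> u_pos v_pos by (intro card_two_points) auto
    finally show "card {i\<in>{1..n}. A i (f i) > 0} = 2"
      unfolding card_R .
  qed
  have left: "left_diag_sum n A = u a + v b" "card {i\<in>{1..n}. A i i > 0} = 2"
    unfolding left_diag_sum_def
    using diag[of a b "\<lambda>i. i"] left_u left_v lt by (auto simp: \<sigma>_def)
  \<comment> \<open>Row indices are at most \<open>n\<close>, so the truncated subtraction is a true
    one.\<close>
  have anti: "n + 1 - R k = C l \<longleftrightarrow> R k + C l = n + 1" if "k < n" "l < n" for k l
    using R_in[OF that(1)] C_in[OF that(2)] by auto
  have right_v': "R k + C (\<sigma> k) = n + 1 \<longleftrightarrow> k = d" if "k < n" for k
    using right_v[OF that] by (simp only: \<sigma>_def)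
  have right: "right_diag_sum n A = u c + v d" "card {i\<in>{1..n}. A i (n + 1 - i) > 0} = 2"
    unfolding right_diag_sum_def
    using lt by (intro diag[of c d "\<lambda>i. n + 1 - i"];
      simp add: anti \<sigma>_lt right_u right_v' del: One_nat_def)+

  have line: "line_sums n A = {s..<s + (2 * n + 2)}"
  proof -
    have "row_sum n A ` {1..n} = row_sum n A ` R ` {..<n}"
      using R by (simp add: bij_betw_def)
    also have "\<dots> = (\<lambda>k. u k + v k) ` {..<n}"
      unfolding image_image by (intro image_cong) (auto simp: row)
    finally have rows: "row_sum n A ` {1..n} = (\<lambda>k. u k + v k) ` {..<n}" .
    have "col_sum n A ` {1..n} = col_sum n A ` (C \<circ> \<sigma>) ` {..<n}"
      using bij_betw_trans[OF \<sigma> C] by (simp add: bij_betw_def)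
    also have "\<dots> = (\<lambda>k. v k + u (\<sigma> k)) ` {..<n}"
      unfolding image_image by (intro image_cong) (auto simp: col)
    finally show ?thesis
      unfolding line_sums_def rows left right sums[symmetric] by (simp add: \<sigma>_def)
  qed
  have range: "A i j \<in> {0..n * 2}" if i: "i \<in> {1..n}" for i j
  proof -
    obtain k where "k < n" "i = R k" using rowE[OF i] by blast
    then show ?thesis
      using u_le[of k] v_le[of k] by (simp add: AR)
  qed
  have unique: "\<exists>!p. p \<in> {1..n} \<times> {1..n} \<and> A (fst p) (snd p) = x"
    if x: "x \<in> {1..n * 2}" for x
  proof -
    have "x \<in> u ` {..<n} \<union> v ` {..<n}"
      unfolding labels using x by (simp add: mult.commute)
    then obtain k where k: "k < n" "x = u k \<or> x = v k" by auto
    define p where "p = (R k, if x = u k then C k else C (\<sigma> k))"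
    show ?thesis
    proof (intro ex1I[of _ p] conjI)
      show "p \<in> {1..n} \<times> {1..n}"
        using k R_in C_in \<sigma>_lt by (auto simp: p_def)
      show "A (fst p) (snd p) = x"
        using k C_eq[OF \<sigma>_lt, of k k] \<sigma>_neq[of k] by (auto simp: p_def AR)
    next
      fix q assume q: "q \<in> {1..n} \<times> {1..n} \<and> A (fst q) (snd q) = x"
      then obtain l where l: "l < n" "fst q = R l"
        using rowE[of "fst q"] by auto
      have "x > 0" using x by simp
      then have cases: "snd q = C l \<and> x = u l \<or> snd q = C (\<sigma> l) \<and> x = v l"
        using q l by (auto simp: AR split: if_splits)
      \<comment> \<open>As the label sets are disjoint, \<open>x\<close> alone decides between a
        \<open>u\<close>-cell and a \<open>v\<close>-cell; injectivity then fixes the row.\<close>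
      have uv: "u k \<noteq> v l" "u l \<noteq> v k"
        using disj k(1) l(1) by blast+
      have "k = l"
        using cases k l uv inj_u inj_v by (auto simp: inj_on_def)
      then show "q = p"
        using cases k l uv by (auto simp: p_def prod_eq_iff)
    qed
  qed
  have "is_SAMS n 2 A"
    unfolding is_SAMS_def
    by (intro conjI ballI exI[of _ s] line unique range) (use n in auto)
  then have "is_regular_SAMS n 2 A"
    unfolding is_regular_SAMS_def using left(2) right(2) row(2) col(2) rowE colE by blast
  then show ?thesis by blast
qed

section \<open>Toroidal lines of slope 1/2\<close>

lemma bij_betw_affine_mod:
  fixes n :: nat
  assumes "n > 0" "coprime m n"
  shows "bij_betw (\<lambda>k. Suc ((m * k + t) mod n)) {..<n} {1..n}"
proof -
  have "inj_on (\<lambda>k. Suc ((m * k + t) mod n)) {..<n}"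
  proof (rule inj_onI)
    fix k l assume kl: "k \<in> {..<n}" "l \<in> {..<n}"
      and "Suc ((m * k + t) mod n) = Suc ((m * l + t) mod n)"
    then have "[m * k + t = m * l + t] (mod n)" by (simp add: cong_def)
    then have "[k = l] (mod n)"
      using assms by (simp add: cong_add_rcancel_nat cong_mult_lcancel_nat)
    then show "k = l" using kl by (simp add: cong_def)
  qed
  moreover have "(\<lambda>k. Suc ((m * k + t) mod n)) ` {..<n} \<subseteq> {1..n}"
    using assms(1) by (auto simp: Suc_le_eq)
  ultimately show ?thesis
    by (simp add: bij_betw_def card_image card_subset_eq)
qed

text \<open>This turns membership in the right diagonal into a divisibility. With residues
  \<open>p\<close> and \<open>q\<close>, the number \<open>p + q + 1\<close> lies between 1 and
  \<open>2 * n - 1\<close>, where \<open>n\<close> is the only multiple of \<open>n\<close>.\<close>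

lemma mod_sum_eq_pred_iff:
  fixes n :: nat
  assumes "n > 0"
  shows "Suc (x mod n) + Suc (y mod n) = n + 1 \<longleftrightarrow> n dvd x + y + 1"
proof -
  define p q where "p = x mod n" and "q = y mod n"
  have "p < n" "q < n" using assms by (simp_all add: p_def q_def)
  have "n dvd x + y + 1 \<longleftrightarrow> n dvd p + q + 1"
    unfolding p_def q_def dvd_eq_mod_eq_0 by (metis mod_add_eq mod_add_left_eq)
  also have "\<dots> \<longleftrightarrow> p + q + 1 = n"
  proof
    assume "n dvd p + q + 1"
    then obtain t where t: "p + q + 1 = n * t" by (elim dvdE)
    have "t < 2"
    proof (rule ccontr)
      assume "\<not> t < 2"
      then have "n * 2 \<le> n * t" by (intro mult_le_mono2) simp
      then show False using t \<open>p < n\<close> \<open>q < n\<close> by linarith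
    qed
    then show "p + q + 1 = n" using t by (cases t) auto
  qed auto
  finally show ?thesis by (auto simp: p_def q_def)
qed

text \<open>Oddness of \<open>n\<close> makes \<open>R\<close> a bijection, and invertibility of 3
  makes each line meet the right diagonal once. The two divisibilities add up to
  \<open>n dvd 3 * (c + d + 4)\<close>, hence \<open>n dvd c + d + 4\<close>.\<close>

lemma regular_SAMS_from_labels:
  fixes u v :: "nat \<Rightarrow> nat" and n h :: nat
  assumes n: "n = 2 * h + 1" "h \<ge> 2" "coprime 3 n"
    and inj_u: "inj_on u {..<n}" and inj_v: "inj_on v {..<n}"
    and disj: "u ` {..<n} \<inter> v ` {..<n} = {}"
    and labels: "u ` {..<n} \<union> v ` {..<n} = {1..2 * n}"
    and c: "c < n" "n dvd 3 * c + h + 6" and d: "d < n" "n dvd 3 * d + h + 7"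
    and sums: "(\<lambda>k. u k + v k) ` {..<n} \<union> (\<lambda>k. v k + u (Suc k mod n)) ` {..<n} \<union>
      {u (h - 1) + v h, u c + v d} = {s..<s + (2 * n + 2)}"
  shows "\<exists>A. is_regular_SAMS n 2 A"
proof -
  define R where "R = (\<lambda>k. Suc ((2 * k + 3) mod n))"
  \<comment> \<open>The difference \<open>h - 1\<close> of the offsets is the position where the
    \<open>u\<close>-line meets the left diagonal. The factor 1 fits
    \<open>bij_betw_affine_mod\<close>.\<close>
  define C where "C = (\<lambda>k. Suc ((1 * k + (h + 2)) mod n))"
  have CS: "C (Suc k mod n) = Suc ((k + h + 3) mod n)" for k
    unfolding C_def mult_1 mod_add_left_eq by (simp add: eval_nat_numeral)
  have three: "k = l" if "n dvd 3 * k + t" "n dvd 3 * l + t" "k < n" "l < n" for k l t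
  proof -
    have "[3 * k + t = 3 * l + t] (mod n)"
      using that(1,2) by (simp add: cong_def dvd_eq_mod_eq_0)
    then have "[k = l] (mod n)"
      using n(3) by (simp add: cong_add_rcancel_nat cong_mult_lcancel_nat)
    then show "k = l" using that by (simp add: cong_def)
  qed
  show ?thesis
  proof (rule regular_SAMS_from_cycle[OF _ _ _ inj_u inj_v disj labels _ _ _ _ _ _ _ _ sums])
    show "bij_betw R {..<n} {1..n}" "bij_betw C {..<n} {1..n}"
      unfolding R_def C_def using n by (intro bij_betw_affine_mod; simp)+
  next
    fix k assume k: "k < n"
    \<comment> \<open>Splitting off a common summand leaves a congruence between numbers at most
      \<open>n\<close>, with \<open>0 < h < n\<close> on the right.\<close>
    have "R k = C k \<longleftrightarrow> [(k + 2) + (k + 1) = (k + 2) + h] (mod n)"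
    proof -
      have "2 * k + 3 = (k + 2) + (k + 1)" "1 * k + (h + 2) = (k + 2) + h" by simp_all
      then show ?thesis by (simp only: R_def C_def cong_def nat.inject)
    qed
    also have "\<dots> \<longleftrightarrow> [k + 1 = h] (mod n)"
      by (rule cong_add_lcancel_nat)
    also have "\<dots> \<longleftrightarrow> k = h - 1"
      using k n(1,2) by (cases "k + 1 = n") (auto simp: cong_def)
    finally show "R k = C k \<longleftrightarrow> k = h - 1" .
    have "R k = C (Suc k mod n) \<longleftrightarrow> [(k + 3) + k = (k + 3) + h] (mod n)"
    proof -
      have "2 * k + 3 = (k + 3) + k" "k + h + 3 = (k + 3) + h" by simp_all
      then show ?thesis by (simp only: R_def CS cong_def nat.inject)
    qed
    also have "\<dots> \<longleftrightarrow> [k = h] (mod n)"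
      by (rule cong_add_lcancel_nat)
    also have "\<dots> \<longleftrightarrow> k = h"
      using k n(1) by (auto simp: cong_def)
    finally show "R k = C (Suc k mod n) \<longleftrightarrow> k = h" .
    have "R k + C k = n + 1 \<longleftrightarrow> n dvd 3 * k + (h + 6)"
      unfolding R_def C_def using n(1) by (subst mod_sum_eq_pred_iff) (auto simp: algebra_simps)
    then show "R k + C k = n + 1 \<longleftrightarrow> k = c"
      using three[of k "h + 6" c] k c by (auto simp: add.assoc)
    have "R k + C (Suc k mod n) = n + 1 \<longleftrightarrow> n dvd 3 * k + (h + 7)"
      unfolding R_def CS using n(1) by (subst mod_sum_eq_pred_iff) (auto simp: algebra_simps)
    then show "R k + C (Suc k mod n) = n + 1 \<longleftrightarrow> k = d"
      using three[of k "h + 7" d] k d by (auto simp: add.assoc)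
  qed (use n c d in auto)
qed

section \<open>The labellings\<close>

lemma regular_SAMS_5: "\<exists>A. is_regular_SAMS 5 2 A"
proof -
  have "{..<5::nat} = {0, 1, 2, 3, 4}" by code_simp
  moreover have "{1..2 * 5::nat} = {1, 2, 3, 4, 5, 6, 7, 8, 9, 10}" by code_simp
  moreover have "{5..<5 + (2 * 5 + 2)::nat} = {5, 6, 7, 8, 9, 10, 11, 12, 13, 14, 15, 16}" by code_simp
  \<comment> \<open>Divisibility forces \<open>c = n - 1\<close>, a position that the general
    labelling excludes.\<close>
  ultimately show ?thesis
    by (intro regular_SAMS_from_labels[where h = 2 and c = 4 and d = 2 and s = 5 and
      u = "(!) [2, 7, 3, 10, 1]" and v = "(!) [6, 9, 4, 5, 8]"])
     (simp_all, auto simp: prime_imp_coprime)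
qed

lemma regular_SAMS_7: "\<exists>A. is_regular_SAMS 7 2 A"
proof -
  have "{..<7::nat} = {0, 1, 2, 3, 4, 5, 6}" by code_simp
  moreover have "{1..2 * 7::nat} = {1, 2, 3, 4, 5, 6, 7, 8, 9, 10, 11, 12, 13, 14}" by code_simp
  moreover have "{7..<7 + (2 * 7 + 2)::nat} =
    {7, 8, 9, 10, 11, 12, 13, 14, 15, 16, 17, 18, 19, 20, 21, 22}" by code_simp
  \<comment> \<open>Here it is \<open>d\<close> that is forced to be \<open>n - 1\<close>.\<close>
  ultimately show ?thesis
    by (intro regular_SAMS_from_labels[where h = 3 and c = 4 and d = 6 and s = 7 and
      u = "(!) [1, 2, 3, 12, 4, 9, 13]" and v = "(!) [6, 14, 10, 7, 11, 5, 8]"])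
     (simp_all, auto simp: prime_imp_coprime)
qed

text \<open>An exchange within a row keeps the row sum and changes only two neighbouring column
  sums. The conditions on \<open>c\<close> and \<open>d\<close> keep the right diagonal off the
  exchanged labels, and \<open>c + d + 4 = n\<close> gives it the sum
  \<open>2 * n - 1\<close>.\<close>

lemma regular_SAMS_large:
  fixes n h c d :: nat
  assumes n: "n = 2 * h + 1" "h \<ge> 5" "coprime 3 n"
    and c: "c < n" "n dvd 3 * c + h + 6" and d: "d < n" "n dvd 3 * d + h + 7"
    and cd: "c \<noteq> h - 1" "c \<noteq> n - 1" "d \<noteq> h - 1" "d \<noteq> n - 1" "c + d + 4 = n"
  shows "\<exists>A. is_regular_SAMS n 2 A"
proof -
  \<comment> \<open>The plain zigzag has \<open>n + 1 + k\<close> and \<open>k + 2\<close> in row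
    \<open>k\<close>, except for \<open>2 * n\<close> and 1 in the last row, where
    \<open>n + 1\<close> is already taken.\<close>
  define u where "u = (\<lambda>k. if k = h - 1 then h + 1 else if k = n - 1 then 1 else n + 1 + k)"
  define v where "v = (\<lambda>k. if k = h - 1 then n + h else if k = n - 1 then 2 * n else k + 2)"
  show ?thesis
  proof (rule regular_SAMS_from_labels[OF n(1) _ n(3) _ _ _ _ c d])
    show "h \<ge> 2" using n by simp
    show "inj_on u {..<n}" "inj_on v {..<n}"
      unfolding inj_on_def u_def v_def using n by auto
    show "u ` {..<n} \<inter> v ` {..<n} = {}"
      using n by (auto simp: u_def v_def split: if_splits)
    show "u ` {..<n} \<union> v ` {..<n} = {1..2 * n}"
    proof (intro equalityI subsetI)
      fix x assume x: "x \<in> {1..2 * n}"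
      \<comment> \<open>Outside the two exchanged rows, \<open>v\<close> takes labels up to
        \<open>n\<close> and \<open>u\<close> those above.\<close>
      consider "x = 1" | "x = h + 1" | "x = n + h" | "x = 2 * n" |
        "2 \<le> x" "x \<le> n" "x \<noteq> h + 1" | "n < x" "x < 2 * n" "x \<noteq> n + h"
        using x by force
      then show "x \<in> u ` {..<n} \<union> v ` {..<n}"
      proof cases
        case 1
        then show ?thesis using n by (intro UnI1 image_eqI[of _ _ "n - 1"]) (auto simp: u_def)
      next
        case 2
        then show ?thesis using n by (intro UnI1 image_eqI[of _ _ "h - 1"]) (auto simp: u_def)
      next
        case 3
        then show ?thesis using n by (intro UnI2 image_eqI[of _ _ "h - 1"]) (auto simp: v_def)
      next
        case 4
        then show ?thesis using n by (intro UnI2 image_eqI[of _ _ "n - 1"]) (auto simp: v_def)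
      next
        case 5
        then show ?thesis using n by (intro UnI2 image_eqI[of _ _ "x - 2"]) (auto simp: v_def)
      next
        case 6
        then show ?thesis using n by (intro UnI1 image_eqI[of _ _ "x - (n + 1)"]) (auto simp: u_def)
      qed
    qed (use n in \<open>auto simp: u_def v_def split: if_splits\<close>)
    have row: "u k + v k = (if k = n - 1 then 2 * n + 1 else n + 3 + 2 * k)" for k
      using n by (auto simp: u_def v_def)
    \<comment> \<open>The exchange in row \<open>h - 1\<close> moves the sums
      \<open>2 * n - 1\<close> and \<open>2 * n + 1\<close> to \<open>n\<close> and
      \<open>3 * n\<close>; the one in row \<open>n - 1\<close> moves \<open>3 * n\<close> and
      \<open>n + 2\<close> to \<open>n + 1\<close> and \<open>3 * n + 1\<close>. The last row now
      has \<open>2 * n + 1\<close> to itself.\<close>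
    have col: "v k + u (Suc k mod n) = (if k = n - 1 then 3 * n + 1 else if k = n - 2 then n + 1
      else if k = h - 1 then 3 * n else if k = h - 2 then n else n + 4 + 2 * k)" if "k < n" for k
      using n that by (cases "k = n - 1") (auto simp: u_def v_def)
    have diags: "u (h - 1) + v h = n + 2" "u c + v d = 2 * n - 1"
      using n cd by (auto simp: u_def v_def)
    have rowI: "x \<in> (\<lambda>k. u k + v k) ` {..<n}" if "u k + v k = x" "k < n" for x k
      using that by auto
    have colI: "x \<in> (\<lambda>k. v k + u (Suc k mod n)) ` {..<n}" if "v k + u (Suc k mod n) = x" "k < n" for x k
      using that by (intro image_eqI[of _ _ k]) auto
    show "(\<lambda>k. u k + v k) ` {..<n} \<union> (\<lambda>k. v k + u (Suc k mod n)) ` {..<n} \<union>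
      {u (h - 1) + v h, u c + v d} = {n..<n + (2 * n + 2)}" (is "?S = ?T")
    proof (intro equalityI subsetI)
      fix x assume "x \<in> ?S"
      then consider k where "x = u k + v k" "k < n" |
        k where "x = v k + u (Suc k mod n)" "k < n" | "x = n + 2" | "x = 2 * n - 1"
        unfolding diags by blast
      then show "x \<in> ?T"
      proof cases
        case (2 k)
        then show ?thesis
          using n(1,2) unfolding 2(1) col[OF 2(2)] by simp
      qed (use n in \<open>auto simp: row\<close>)
    next
      fix x assume x: "x \<in> ?T"
      consider "x = 3 * n + 1" | "x = 3 * n" | "x = n" | "x = n + 1" | "x = n + 2" |
        "x = 2 * n - 1" | "x = 2 * n + 1" | t where "x = n + 3 + 2 * t" "t < n - 1" |
        t where "x = n + 4 + 2 * t" "t < n - 2" "t \<noteq> h - 1" "t \<noteq> h - 2"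
      \<comment> \<open>As \<open>n\<close> is odd, the generic row sums are the even values and the
        generic column sums the odd ones; solving for the position gives \<open>y - h - 2\<close> in
        both cases.\<close>
      proof (cases "even x")
        case True
        then obtain y where y: "x = 2 * y" by (elim evenE)
        then have "y = h + 1 \<or> y = 3 * h + 2 \<or> h + 2 \<le> y \<and> y < 3 * h + 2"
          using x n(1) by (simp, arith)
        then have "x = n + 1 \<or> x = 3 * n + 1 \<or> x = n + 3 + 2 * (y - h - 2) \<and> y - h - 2 < n - 1"
          using y n(1,2) by auto
        then show ?thesis using that by blast
      next
        case False
        then obtain y where y: "x = 2 * y + 1" by (elim oddE)
        then have "y \<in> {3 * h + 1, h, h + 1, 2 * h, 2 * h + 1} \<or>
            h + 2 \<le> y \<and> y \<le> 3 * h \<and> y \<noteq> 2 * h \<and> y \<noteq> 2 * h + 1"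
          using x n(1) by (simp, arith)
        then have "x \<in> {3 * n, n, n + 2, 2 * n - 1, 2 * n + 1} \<or> x = n + 4 + 2 * (y - h - 2) \<and>
            y - h - 2 < n - 2 \<and> y - h - 2 \<noteq> h - 1 \<and> y - h - 2 \<noteq> h - 2"
          using y n(1,2) by auto
        then show ?thesis using that by blast
      qed
      then show "x \<in> ?S"
      proof cases
        case 1
        then show ?thesis using n col[of "n - 1"] by (intro UnI1[OF UnI2] colI[of "n - 1"]) auto
      next
        case 2
        then show ?thesis using n col[of "h - 1"] by (intro UnI1[OF UnI2] colI[of "h - 1"]) auto
      next
        case 3
        then show ?thesis using n col[of "h - 2"] by (intro UnI1[OF UnI2] colI[of "h - 2"]) auto
      next
        case 4
        then show ?thesis using n col[of "n - 2"] by (intro UnI1[OF UnI2] colI[of "n - 2"]) auto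
      next
        case 7
        then show ?thesis using n by (intro UnI1 rowI[of "n - 1"]) (auto simp: row)
      next
        case (8 t)
        then show ?thesis using n by (intro UnI1 rowI[of t]) (auto simp: row)
      next
        case (9 t)
        then show ?thesis using n col[of t] by (intro UnI1[OF UnI2] colI[of t]) auto
      qed (use diags in auto)
    qed
  qed
qed

section \<open>Position of the right diagonal in each residue class\<close>

theorem theorem2p1:
  fixes n :: nat
  assumes "n \<ge> 5"
    and "n mod 6 = 1 \<or> n mod 6 = 5"
  shows "\<exists>A. is_regular_SAMS n 2 A"
proof -
  define m where "m = n div 6"
  have div_mod: "n = 6 * m + n mod 6"
    by (simp add: m_def)
  show ?thesis
  proof (cases "n mod 6 = 1")
    case True
    then have n: "n = 6 * m + 1"
      using div_mod by simp
    show ?thesis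
    proof (cases "m \<ge> 2")
      case True
      have "coprime 3 n"
        by (rule prime_imp_coprime) (use n in \<open>simp, presburger\<close>)
      \<comment> \<open>The quotients are known modulo 3: 0 for \<open>c\<close> and 1 for
        \<open>d\<close>. By size they are 3 and 1, which determines both witnesses.\<close>
      moreover have "n dvd 3 * (5 * m - 1) + 3 * m + 6"
        by (rule dvdI[of _ _ 3]) (use n True in simp)
      moreover have "n dvd 3 * (m - 2) + 3 * m + 7"
        by (rule dvdI[of _ _ 1]) (use n True in simp)
      ultimately show ?thesis
        using n True
        by (intro regular_SAMS_large[of n "3 * m" "5 * m - 1" "m - 2"]) auto
    next
      case False
      then have "n = 7" using n assms(1) by auto
      then show ?thesis using regular_SAMS_7 by simp
    qed
  next
    case False
    then have n: "n = 6 * m + 5"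
      using div_mod assms(2) by simp
    show ?thesis
    proof (cases "m = 0")
      case True
      then show ?thesis using n regular_SAMS_5 by simp
    next
      case False
      have "coprime 3 n"
        by (rule prime_imp_coprime) (use n in \<open>simp, presburger\<close>)
      \<comment> \<open>Now \<open>n\<close> is 2 modulo 3, and the quotients are 1 for
        \<open>c\<close> and 3 for \<open>d\<close>.\<close>
      moreover have "n dvd 3 * (m - 1) + (3 * m + 2) + 6"
        by (rule dvdI[of _ _ 1]) (use n False in simp)
      moreover have "n dvd 3 * (5 * m + 2) + (3 * m + 2) + 7"
        by (rule dvdI[of _ _ 3]) (use n False in simp)
      ultimately show ?thesis
        using n False
        by (intro regular_SAMS_large[of n "3 * m + 2" "m - 1" "5 * m + 2"]) auto
    qed
  qed
qed

end
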